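(* (i) Let $k\ge 2$ be an integer. Then there exist piecewise rigid functions $f_1,\dots,f_k:\mathbb{R}\to\mathbb{R}$ and a partition of $\mathbb{R}$ into $2k$ pairwise disjoint subsets $A_1,B_1,\dots,A_k,B_k$ (with union $\mathbb{R}$) such that \[A_j\sqcup f_j(B_j)=\mathbb{R}\quad\text{for every } 1\le j\le k.\] (ii) Furthermore, there exist a sequence of piecewise rigid functions $f_1,f_2,\dots:\mathbb{R}\to\mathbb{R}$ and a partition of $\mathbb{R}$ into countably infinitely many pairwise disjoint subsets $A_1,B_1,A_2,B_2,\dots$ (with union $\mathbb{R}$) such that \[A_j\sqcup f_j(B_j)=\mathbb{R}\quad\text{for every } j\ge 1.\]
   Context: A function $f:\mathbb{R}\to\mathbb{R}$ is called piecewise rigid if: (1) $f$ is a bijection; (2) $f$ is differentiable with $|f'(x)|=1$, except at a countable number of jump discontinuities; and (3) the set of discontinuities of $f$ has no limit points in $\mathbb{R}$. The symbol $\sqcup$ denotes disjoint union: an equality $X\sqcup Y=Z$ means $X\cap Y=\emptyset$ and $X\cup Y=Z$. For a set $S\subseteq\mathbb{R}$, $f(S)$ is the image of $S$ under $f$. *)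

theory Defs
  imports "HOL-Analysis.Analysis"
begin

text \<open>Both one-sided limits exist in the reals and are different; in particular a removable
  discontinuity is not a jump discontinuity.\<close>

definition jump_discontinuity :: "(real \<Rightarrow> real) \<Rightarrow> real \<Rightarrow> bool" where
  "jump_discontinuity f x \<longleftrightarrow>
     (\<exists>l r. (f \<longlongrightarrow> l) (at_left x) \<and> (f \<longlongrightarrow> r) (at_right x) \<and> l \<noteq> r)"

definition piecewise_rigid :: "(real \<Rightarrow> real) \<Rightarrow> bool" where
  "piecewise_rigid f \<longleftrightarrow>
     bij f \<and>
     (\<exists>E. countable E \<and>
          (\<forall>x\<in>E. jump_discontinuity f x) \<and>
          (\<forall>x. x \<notin> E \<longrightarrow> (\<exists>d. (f has_real_derivative d) (at x) \<and> \<bar>d\<bar> = 1))) \<and>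
     (\<forall>x. \<not> x islimpt {y. \<not> isCont f y})"

text \<open>The sets \<open>A j\<close>, \<open>B j\<close> for \<open>j \<in> J\<close> are, as a doubly indexed family, a partition of the real
  line; nonemptiness makes them distinct, so for \<open>card J = k\<close> there are exactly \<open>2 * k\<close> parts.\<close>

definition partition_of_reals :: "nat set \<Rightarrow> (nat \<Rightarrow> real set) \<Rightarrow> (nat \<Rightarrow> real set) \<Rightarrow> bool" where
  "partition_of_reals J A B \<longleftrightarrow>
     (\<forall>j\<in>J. A j \<noteq> {} \<and> B j \<noteq> {}) \<and>
     disjoint_family_on A J \<and> disjoint_family_on B J \<and>
     (\<forall>i\<in>J. \<forall>j\<in>J. A i \<inter> B j = {}) \<and>
     (\<Union>j\<in>J. A j \<union> B j) = UNIV"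

definition is_disjoint_union :: "'a set \<Rightarrow> 'a set \<Rightarrow> 'a set \<Rightarrow> bool" where
  "is_disjoint_union X Y Z \<longleftrightarrow> X \<inter> Y = {} \<and> X \<union> Y = Z"

end

theory Submission
  imports Defs
begin

text \<open>Every permutation of the integers, acting on the unit intervals \<open>[n, n + 1)\<close>, lifts to a
  piecewise rigid bijection of the line. So it suffices to split the integers into infinite sets
  \<open>A\<^sub>j, B\<^sub>j\<close>: both \<open>B\<^sub>j\<close> and the complement of \<open>A\<^sub>j\<close> are then infinite with infinite complement,
  and hence some permutation carries the first to the second.\<close>

definition interval_permutation :: "(int \<Rightarrow> int) \<Rightarrow> real \<Rightarrow> real" where
  "interval_permutation \<sigma> x = of_int (\<sigma> \<lfloor>x\<rfloor>) + frac x"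

lemma floor_interval_permutation [simp]: "\<lfloor>interval_permutation \<sigma> x\<rfloor> = \<sigma> \<lfloor>x\<rfloor>"
  by (simp add: interval_permutation_def floor_eq_iff frac_lt_1)

lemma frac_interval_permutation [simp]: "frac (interval_permutation \<sigma> x) = frac x"
  unfolding frac_def [of "interval_permutation \<sigma> x"]
  by (simp add: interval_permutation_def)

text \<open>The lift changes only the floor and keeps the fractional part, so it respects
  composition. Hence \<open>inv \<sigma>\<close> lifts to the inverse map.\<close>

lemma interval_permutation_comp:
  "interval_permutation \<sigma> (interval_permutation \<tau> x) = interval_permutation (\<sigma> \<circ> \<tau>) x"
  unfolding interval_permutation_def [of \<sigma>] by (simp add: interval_permutation_def [of "\<sigma> \<circ> \<tau>"])

lemma interval_permutation_id [simp]: "interval_permutation id x = x"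
  by (simp add: interval_permutation_def frac_def)

lemma interval_permutation_inverse:
  assumes "bij \<sigma>"
  shows "interval_permutation \<sigma> (interval_permutation (inv \<sigma>) x) = x"
    and "interval_permutation (inv \<sigma>) (interval_permutation \<sigma> x) = x"
  using assms
  by (simp_all add: interval_permutation_comp bij_is_inj surj_iff [THEN iffD1] bij_is_surj)

lemma bij_interval_permutation: "bij \<sigma> \<Longrightarrow> bij (interval_permutation \<sigma>)"
  by (rule o_bij [where g = "interval_permutation (inv \<sigma>)"])
     (auto simp: interval_permutation_inverse)

text \<open>A union of unit intervals is a preimage under \<open>floor\<close>; this lemma transfers
  set equations from the integers to the line.\<close>

lemma image_interval_permutation:
  assumes "bij \<sigma>"
  shows "interval_permutation \<sigma> ` (floor -` S) = floor -` (\<sigma> ` S)"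
proof (intro equalityI subsetI)
  fix y :: real assume "y \<in> floor -` (\<sigma> ` S)"
  then have "interval_permutation (inv \<sigma>) y \<in> floor -` S"
    using assms by (auto simp: bij_is_inj)
  then show "y \<in> interval_permutation \<sigma> ` (floor -` S)"
    using interval_permutation_inverse(1) [OF assms] by (metis imageI)
qed auto

lemma interval_permutation_eq_translation:
  assumes "of_int n \<le> x" "x < of_int n + 1"
  shows "interval_permutation \<sigma> x = x + of_int (\<sigma> n - n)"
proof -
  have "\<lfloor>x\<rfloor> = n" using assms by (simp add: floor_eq_iff)
  then show ?thesis by (simp add: interval_permutation_def frac_def)
qed

lemma interval_permutation_tendsto_right:
  "(interval_permutation \<sigma> \<longlongrightarrow> of_int (\<sigma> n)) (at_right (of_int n))"
proof (rule Lim_transform_eventually)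
  have "((\<lambda>x. x + of_int (\<sigma> n - n)) \<longlongrightarrow> of_int n + of_int (\<sigma> n - n)) (at_right (of_int n :: real))"
    by (intro tendsto_intros)
  then show "((\<lambda>x. x + of_int (\<sigma> n - n)) \<longlongrightarrow> of_int (\<sigma> n)) (at_right (of_int n :: real))"
    by simp
  show "\<forall>\<^sub>F x in at_right (of_int n). x + of_int (\<sigma> n - n) = interval_permutation \<sigma> x"
    by (rule eventually_at_rightI [of _ "of_int n + 1"])
       (auto simp: interval_permutation_eq_translation [of n])
qed

text \<open>Just left of \<open>n\<close> the translation in force is that of [n - 1, n). Comparison
  with the right limit shows a jump at \<open>n\<close> exactly when
  \<open>\<sigma> (n - 1) + 1 \<noteq> \<sigma> n\<close>.\<close>

lemma interval_permutation_tendsto_left: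
  "(interval_permutation \<sigma> \<longlongrightarrow> of_int (\<sigma> (n - 1) + 1)) (at_left (of_int n))"
proof (rule Lim_transform_eventually)
  let ?c = "of_int (\<sigma> (n - 1) - (n - 1)) :: real"
  have "((\<lambda>x. x + ?c) \<longlongrightarrow> of_int n + ?c) (at_left (of_int n))"
    by (intro tendsto_intros)
  then show "((\<lambda>x. x + ?c) \<longlongrightarrow> of_int (\<sigma> (n - 1) + 1)) (at_left (of_int n))"
    by simp
  show "\<forall>\<^sub>F x in at_left (of_int n). x + ?c = interval_permutation \<sigma> x"
    by (rule eventually_at_leftI [of "of_int n - 1"])
       (auto simp: interval_permutation_eq_translation [of "n - 1"])
qed

lemma has_real_derivative_interval_permutation:
  assumes "x \<notin> of_int ` {n. \<sigma> (n - 1) + 1 \<noteq> \<sigma> n}"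
  shows "(interval_permutation \<sigma> has_real_derivative 1) (at x)"
proof -
  define n where "n = \<lfloor>x\<rfloor>"
  obtain S where S: "open S" "x \<in> S"
    "\<And>y. y \<in> S \<Longrightarrow> y + of_int (\<sigma> n - n) = interval_permutation \<sigma> y"
  proof (cases "x = of_int n")
    case True
    with assms have "\<sigma> (n - 1) + 1 = \<sigma> n" by auto
    \<comment> \<open>Without a jump at \<open>n\<close>, both adjacent intervals are translated by
      the same amount, so one translation works on an open neighbourhood of
      \<open>n\<close>.\<close>
    then have "y + of_int (\<sigma> n - n) = interval_permutation \<sigma> y"
      if "y \<in> {of_int n - 1<..<of_int n + 1}" for y
      using that interval_permutation_eq_translation [of n y \<sigma>]
        interval_permutation_eq_translation [of "n - 1" y \<sigma>]
      by (cases "of_int n \<le> y") auto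
    with True show thesis by (intro that [of "{of_int n - 1<..<of_int n + 1}"]) auto
  next
    case False
    moreover have "of_int n \<le> x" "x < of_int n + 1"
      unfolding n_def by linarith+
    ultimately have "x \<in> {of_int n<..<of_int n + 1}" by simp
    then show thesis
      by (intro that [of "{of_int n<..<of_int n + 1}"])
         (auto simp: interval_permutation_eq_translation [of n])
  qed
  have "((\<lambda>y. y + of_int (\<sigma> n - n)) has_real_derivative 1) (at x)"
    by (auto intro!: derivative_eq_intros)
  then show ?thesis using S by (rule has_field_derivative_transform_within_open)
qed

lemma not_islimpt_Ints: "\<not> x islimpt (\<int> :: real set)"
  by (rule discrete_imp_not_islimpt [of 1]) (auto simp: dist_of_int elim!: Ints_cases)

lemma piecewise_rigid_interval_permutation:
  assumes "bij \<sigma>"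
  shows "piecewise_rigid (interval_permutation \<sigma>)"
  unfolding piecewise_rigid_def
proof (intro conjI exI [of _ "of_int ` {n. \<sigma> (n - 1) + 1 \<noteq> \<sigma> n}"] allI ballI impI)
  \<comment> \<open>Not all integers may be excluded: where consecutive intervals stay consecutive,
    the map is continuous and there is no jump.\<close>
  let ?E = "of_int ` {n. \<sigma> (n - 1) + 1 \<noteq> \<sigma> n} :: real set"
  show "bij (interval_permutation \<sigma>)"
    using assms by (rule bij_interval_permutation)
  show "countable ?E" by simp
  show "jump_discontinuity (interval_permutation \<sigma>) x" if "x \<in> ?E" for x
  proof -
    from that obtain n where x: "x = of_int n" and "\<sigma> (n - 1) + 1 \<noteq> \<sigma> n" by auto
    then have "(of_int (\<sigma> (n - 1) + 1) :: real) \<noteq> of_int (\<sigma> n)"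
      by (simp only: of_int_eq_iff not_False_eq_True)
    then show ?thesis
      unfolding jump_discontinuity_def x
      using interval_permutation_tendsto_left interval_permutation_tendsto_right by blast
  qed
  show "\<exists>d. (interval_permutation \<sigma> has_real_derivative d) (at x) \<and> \<bar>d\<bar> = 1" if "x \<notin> ?E" for x
    using has_real_derivative_interval_permutation [OF that] by auto
  \<comment> \<open>Off the exceptional integers the map is differentiable, hence
    continuous.\<close>
  have "{y. \<not> isCont (interval_permutation \<sigma>) y} \<subseteq> \<int>"
    using has_real_derivative_interval_permutation DERIV_isCont by (fastforce simp: Ints_def)
  then show "\<not> x islimpt {y. \<not> isCont (interval_permutation \<sigma>) y}" for x
    by (metis not_islimpt_Ints islimpt_subset)
qed

text \<open>Any two infinite subsets of a countable type are equinumerous, so a bijection of the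
  sets and one of their complements can be glued together.\<close>

lemma ex_bij_image_eq:
  fixes S T :: "'a::countable set"
  assumes "infinite S" "infinite (- S)" "infinite T" "infinite (- T)"
  obtains \<sigma> where "bij \<sigma>" "\<sigma> ` S = T"
proof -
  have ex: "\<exists>h. bij_betw h X Y" if "infinite X" "infinite Y" for X Y :: "'a set"
  proof -
    have "bij_betw (to_nat_on X) X UNIV" "bij_betw (from_nat_into Y) UNIV Y"
      using that by (auto intro: to_nat_on_infinite bij_betw_from_nat_into)
    then show ?thesis by (meson bij_betw_trans)
  qed
  obtain g h where "bij_betw g S T" "bij_betw h (- S) (- T)"
    using ex assms by meson
  then have "bij_betw (\<lambda>x. if x \<in> S then g x else h x) (S \<union> - S) (T \<union> - T)"
    by (intro bij_betw_disjoint_Un) auto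
  moreover have "(\<lambda>x. if x \<in> S then g x else h x) ` S = T"
    using \<open>bij_betw g S T\<close> by (auto simp: bij_betw_def)
  ultimately show thesis using that by simp
qed

text \<open>Encode integers as pairs of naturals and let the first coordinate enumerate
  \<open>I\<close>. The free second coordinate makes every fibre infinite, even if \<open>I\<close>
  is infinite.\<close>

lemma ex_infinite_fibres:
  assumes "countable I" "I \<noteq> {}"
  shows "\<exists>c :: int \<Rightarrow> 'a. range c \<subseteq> I \<and> (\<forall>i\<in>I. infinite (c -` {i}))"
proof -
  let ?c = "\<lambda>n. from_nat_into I (fst (prod_decode (int_encode n)))"
  have "infinite (?c -` {i})" if "i \<in> I" for i
  proof -
    from that obtain m where m: "from_nat_into I m = i"
      using assms from_nat_into_surj by metis
    \<comment> \<open>Fixing the first coordinate \<open>m\<close> and varying \<open>l\<close>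
      gives infinitely many points of the fibre.\<close>
    have "range (\<lambda>l. int_decode (prod_encode (m, l))) \<subseteq> ?c -` {i}"
      using m by auto
    moreover have "inj (\<lambda>l. int_decode (prod_encode (m, l)))"
      by (auto simp: inj_def dest: injD [OF inj_int_decode] injD [OF inj_prod_encode])
    ultimately show ?thesis
      by (metis finite_subset range_inj_infinite)
  qed
  moreover have "range ?c \<subseteq> I" using assms by (auto intro: from_nat_into)
  ultimately show ?thesis by (intro exI [of _ ?c]) simp
qed

text \<open>Stated for a general index set so that finite and infinite families are handled at once.
  The integers are coloured by \<open>J \<times> UNIV\<close>, with \<open>True\<close> marking
  \<open>A j\<close> and \<open>False\<close> marking \<open>B j\<close>.\<close>

lemma ex_self_covering_partition:
  assumes "countable J" "J \<noteq> {}"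
  shows "\<exists>f A B. (\<forall>j\<in>J. piecewise_rigid (f j)) \<and> partition_of_reals J A B \<and>
    (\<forall>j\<in>J. is_disjoint_union (A j) (f j ` B j) UNIV)"
proof -
  have "countable (J \<times> (UNIV :: bool set))" "J \<times> (UNIV :: bool set) \<noteq> {}"
    using assms by simp_all
  from ex_infinite_fibres [OF this] obtain c :: "int \<Rightarrow> nat \<times> bool" where c: "range c \<subseteq> J \<times> UNIV"
    and inf: "\<And>i. i \<in> J \<times> UNIV \<Longrightarrow> infinite (c -` {i})"
    by blast
  \<comment> \<open>The complement of a colour class contains the class with the other truth value,
    which is infinite.\<close>
  have inf': "infinite (- c -` {(j, b)})" if "j \<in> J" for j b
    using that inf [of "(j, \<not> b)"] by (auto elim!: contrapos_nn intro: rev_finite_subset)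
  \<comment> \<open>Sending the integers of \<open>B j\<close> onto the complement of those of
    \<open>A j\<close> is the required covering, before lifting to the line.\<close>
  have "\<exists>\<sigma>. bij \<sigma> \<and> \<sigma> ` (c -` {(j, False)}) = - c -` {(j, True)}" if "j \<in> J" for j
    using that inf inf' by (auto intro: ex_bij_image_eq [of "c -` {(j, False)}" "- c -` {(j, True)}"])
  then obtain \<sigma> where \<sigma>: "\<And>j. j \<in> J \<Longrightarrow> bij (\<sigma> j)"
      "\<And>j. j \<in> J \<Longrightarrow> \<sigma> j ` (c -` {(j, False)}) = - c -` {(j, True)}"
    by metis
  define part :: "bool \<Rightarrow> nat \<Rightarrow> real set" where "part b j = floor -` (c -` {(j, b)})" for b j
  have "part b j \<noteq> {}" if "j \<in> J" for b j
  proof -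
    obtain n where "c n = (j, b)"
      using inf [of "(j, b)"] \<open>j \<in> J\<close> infinite_imp_nonempty by fastforce
    then have "of_int n \<in> part b j" by (simp add: part_def)
    then show ?thesis by auto
  qed
  moreover have "x \<in> (\<Union>j\<in>J. part True j \<union> part False j)" for x
  proof -
    obtain j b where "c \<lfloor>x\<rfloor> = (j, b)" by fastforce
    moreover from this c have "j \<in> J" by (metis SigmaD1 rangeI subsetD)
    ultimately show ?thesis by (cases b) (auto simp: part_def)
  qed
  ultimately have "partition_of_reals J (part True) (part False)"
    by (auto simp: partition_of_reals_def disjoint_family_on_def part_def)
  moreover have "is_disjoint_union (part True j) (interval_permutation (\<sigma> j) ` part False j) UNIV"
    if "j \<in> J" for j
    using \<sigma> [OF that] by (auto simp: is_disjoint_union_def part_def image_interval_permutation)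
  ultimately show ?thesis
    using \<sigma>(1) piecewise_rigid_interval_permutation
    by (intro exI [of _ "\<lambda>j. interval_permutation (\<sigma> j)"] exI [of _ "part True"]
        exI [of _ "part False"]) auto
qed

theorem theorem4p1:
  shows "(\<forall>k::nat. k \<ge> 2 \<longrightarrow>
           (\<exists>(f :: nat \<Rightarrow> real \<Rightarrow> real) (A :: nat \<Rightarrow> real set) (B :: nat \<Rightarrow> real set).
              (\<forall>j\<in>{1..k}. piecewise_rigid (f j)) \<and>
              partition_of_reals {1..k} A B \<and>
              (\<forall>j\<in>{1..k}. is_disjoint_union (A j) (f j ` B j) UNIV))) \<and>
         (\<exists>(f :: nat \<Rightarrow> real \<Rightarrow> real) (A :: nat \<Rightarrow> real set) (B :: nat \<Rightarrow> real set).
              (\<forall>j\<in>{1..}. piecewise_rigid (f j)) \<and>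
              partition_of_reals {1..} A B \<and>
              (\<forall>j\<in>{1..}. is_disjoint_union (A j) (f j ` B j) UNIV))"
  by (intro conjI allI impI ex_self_covering_partition) auto

end
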